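(* Let $G$ be a locally compact group and let $(A,\alpha)$ be an action of $G$ on a $C^*$-algebra $A$. (1) Suppose that there is a dense $\alpha$-invariant subset $A_0$ of $A$ such that for all $a,b\in A_0$ the function $s\mapsto \alpha_s(a)b$ from $G$ to $A$ is integrable. Then $\alpha$ is s-proper. (2) Suppose that there is a dense $\alpha$-invariant subset $A_0$ of $A$ such that for all $a\in A_0$ and all $\omega\in A^*$ the function $s\mapsto \omega(\alpha_s(a))$ is integrable on $G$. Then $\alpha$ is w-proper.
   Context: An action is a homomorphism $\alpha$ from $G$ to the automorphism group of $A$ such that $s\mapsto\alpha_s(a)$ is norm continuous for each $a\in A$. Integrability is with respect to (left) Haar measure on $G$; for Banach-space-valued functions it means belonging to $L^1(G,A)$ in the (absolute) Bochner sense, so in particular $\int_G\|\alpha_s(a)b\|\,ds<\infty$. The action is s-proper if for all $a,b\in A$ the map $s\mapsto\alpha_s(a)b$ from $G$ to $A$ vanishes at infinity (for every $\epsilon>0$ its norm is $<\epsilon$ off some compact set). It is w-proper if for all $a\in A$ and $\omega\in A^*$ the function $s\mapsto\omega(\alpha_s(a))$ is in $C_0(G)$. *)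

theory Defs
  imports "HOL-Analysis.Analysis"
begin

text \<open>
  C*-algebras, not assumed to be unital, separable or nonzero. The complex scalar multiplication
  extends the real one that the type class \<^class>\<open>banach\<close> provides.
\<close>

class cstar_algebra = banach + real_normed_algebra +
  fixes scaleC :: "complex \<Rightarrow> 'a \<Rightarrow> 'a"  (infixr "*\<^sub>C" 75)
    and star :: "'a \<Rightarrow> 'a"
  assumes scaleC_of_real: "complex_of_real r *\<^sub>C x = r *\<^sub>R x"
    and scaleC_add_right: "c *\<^sub>C (x + y) = c *\<^sub>C x + c *\<^sub>C y"
    and scaleC_add_left: "(c + d) *\<^sub>C x = c *\<^sub>C x + d *\<^sub>C x"
    and scaleC_scaleC: "c *\<^sub>C d *\<^sub>C x = (c * d) *\<^sub>C x"
    and mult_scaleC_left: "(c *\<^sub>C x) * y = c *\<^sub>C (x * y)"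
    and mult_scaleC_right: "x * (c *\<^sub>C y) = c *\<^sub>C (x * y)"
    and norm_scaleC: "norm (c *\<^sub>C x) = cmod c * norm x"
    and star_star: "star (star x) = x"
    and star_add: "star (x + y) = star x + star y"
    and star_scaleC: "star (c *\<^sub>C x) = cnj c *\<^sub>C star x"
    and star_mult: "star (x * y) = star y * star x"
    and cstar_identity: "norm (star x * x) = (norm x)\<^sup>2"

definition star_automorphism :: "('a::cstar_algebra \<Rightarrow> 'a) \<Rightarrow> bool" where
  "star_automorphism \<phi> \<longleftrightarrow> bij \<phi> \<and>
     (\<forall>x y. \<phi> (x + y) = \<phi> x + \<phi> y) \<and>
     (\<forall>c x. \<phi> (c *\<^sub>C x) = c *\<^sub>C \<phi> x) \<and>
     (\<forall>x y. \<phi> (x * y) = \<phi> x * \<phi> y) \<and>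
     (\<forall>x. \<phi> (star x) = star (\<phi> x))"

definition dual_element :: "('a::cstar_algebra \<Rightarrow> complex) \<Rightarrow> bool" where
  "dual_element \<omega> \<longleftrightarrow> bounded_linear \<omega> \<and> (\<forall>c x. \<omega> (c *\<^sub>C x) = c * \<omega> x)"

text \<open>
  Groups are written additively, but \<^class>\<open>topological_group_add\<close> does not assume commutativity.
\<close>

definition cstar_action :: "('g::topological_group_add \<Rightarrow> 'a::cstar_algebra \<Rightarrow> 'a) \<Rightarrow> bool" where
  "cstar_action \<alpha> \<longleftrightarrow>
     (\<forall>s. star_automorphism (\<alpha> s)) \<and>
     (\<forall>s t. \<alpha> (s + t) = \<alpha> s \<circ> \<alpha> t) \<and>
     (\<forall>a. continuous_on UNIV (\<lambda>s. \<alpha> s a))"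

definition action_invariant :: "('g \<Rightarrow> 'a \<Rightarrow> 'a) \<Rightarrow> 'a set \<Rightarrow> bool" where
  "action_invariant \<alpha> S \<longleftrightarrow> (\<forall>s. \<forall>a\<in>S. \<alpha> s a \<in> S)"

text \<open>
  Left Haar measures: nonzero left-invariant Radon measures on the Borel sets, where Radon means
  finite on compact sets, outer regular on Borel sets and inner regular on open sets.
\<close>

definition left_haar_measure :: "'g::{topological_group_add, t2_space} measure \<Rightarrow> bool" where
  "left_haar_measure \<mu> \<longleftrightarrow>
     sets \<mu> = sets borel \<and>
     emeasure \<mu> UNIV \<noteq> 0 \<and>
     (\<forall>s. \<forall>B\<in>sets borel. emeasure \<mu> ((\<lambda>t. s + t) ` B) = emeasure \<mu> B) \<and>
     (\<forall>K. compact K \<longrightarrow> emeasure \<mu> K < \<infinity>) \<and>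
     (\<forall>B\<in>sets borel. emeasure \<mu> B = (INF U\<in>{U. open U \<and> B \<subseteq> U}. emeasure \<mu> U)) \<and>
     (\<forall>U. open U \<longrightarrow> emeasure \<mu> U = (SUP K\<in>{K. compact K \<and> K \<subseteq> U}. emeasure \<mu> K))"

text \<open>
  Absolute Bochner integrability. The library's \<^const>\<open>integrable\<close> requires a second countable
  target, which a C*-algebra need not be; this is the same condition without that requirement.
  A Borel function that satisfies it is almost everywhere separably valued, being an
  \<open>L\<^sup>1\<close>-limit of simple functions.
\<close>

definition bochner_integrable :: "'s measure \<Rightarrow> ('s \<Rightarrow> 'b::real_normed_vector) \<Rightarrow> bool" where
  "bochner_integrable M f \<longleftrightarrow>
     f \<in> borel_measurable M \<and>
     (\<exists>h. (\<forall>i::nat. Bochner_Integration.simple_bochner_integrable M (h i)) \<and>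
          (\<lambda>i. \<integral>\<^sup>+x. ennreal (norm (f x - h i x)) \<partial>M) \<longlonglongrightarrow> 0)"

definition vanishes_at_infinity :: "('g::topological_space \<Rightarrow> 'b::real_normed_vector) \<Rightarrow> bool" where
  "vanishes_at_infinity f \<longleftrightarrow> (\<forall>\<epsilon>>0. \<exists>K. compact K \<and> (\<forall>s. s \<notin> K \<longrightarrow> norm (f s) < \<epsilon>))"

definition C0 :: "('g::topological_space \<Rightarrow> complex) set" where
  "C0 = {f. continuous_on UNIV f \<and> vanishes_at_infinity f}"

definition s_proper :: "('g::topological_group_add \<Rightarrow> 'a::cstar_algebra \<Rightarrow> 'a) \<Rightarrow> bool" where
  "s_proper \<alpha> \<longleftrightarrow> (\<forall>a b. vanishes_at_infinity (\<lambda>s. \<alpha> s a * b))"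

definition w_proper :: "('g::topological_group_add \<Rightarrow> 'a::cstar_algebra \<Rightarrow> 'a) \<Rightarrow> bool" where
  "w_proper \<alpha> \<longleftrightarrow> (\<forall>a \<omega>. dual_element \<omega> \<longrightarrow> (\<lambda>s. \<omega> (\<alpha> s a)) \<in> C0)"

end

theory Submission
  imports Defs
begin

text \<open>
  Both parts rest on one principle. Let \<open>f\<close> be a function on \<open>G\<close> with \<open>\<integral>\<parallel>f\<parallel> < \<infinity>\<close> that is uniformly
  continuous in the sense that \<open>\<parallel>f (s + v) - f s\<parallel>\<close> is small uniformly in \<open>s\<close> for \<open>v\<close> near \<open>0\<close>. If
  \<open>f\<close> did not vanish at infinity, the set \<open>\<parallel>f\<parallel> \<ge> \<epsilon>\<close> would lie in no compact set, so one could pick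
  in it arbitrarily many points \<open>s\<close> with disjoint translates \<open>s + W\<close> of one small open neighbourhood
  \<open>W\<close> of \<open>0\<close>. On each translate \<open>\<parallel>f\<parallel> \<ge> \<epsilon>/2\<close>, and by left invariance all of them have the same
  positive measure, which contradicts the finiteness of the integral
  (\<open>integrable_imp_vanishes_at_infinity\<close>).

  The principle applies to \<open>f s = T (\<alpha>\<^sub>s a)\<close> for a bounded linear \<open>T\<close>, such as right multiplication by
  \<open>b\<close> or a functional \<open>\<omega>\<close>: since \<open>\<alpha>\<^sub>s\<close> is contractive,
  \<open>\<parallel>\<alpha>\<^bsub>s+v\<^esub> a - \<alpha>\<^sub>s a\<parallel> = \<parallel>\<alpha>\<^sub>s (\<alpha>\<^sub>v a - a)\<parallel> \<le> \<parallel>\<alpha>\<^sub>v a - a\<parallel>\<close>, uniformly in \<open>s\<close>. Contractivity also makes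
  vanishing at infinity survive limits in \<open>a\<close> (\<open>bounded_linear_orbit_vanishes\<close>) and, for the
  products \<open>\<alpha>\<^sub>s a * b\<close>, in \<open>b\<close>, so that it passes from the dense set to all of \<open>A\<close>.

  What remains is that a star automorphism \<open>\<phi>\<close>, given only algebraically, is contractive
  (\<open>norm_star_automorphism_le\<close>). By the C*-identity it suffices to treat self-adjoint elements \<open>h\<close>,
  and there the norm is the spectral radius, an algebraic invariant. The fact needed is: if \<open>k\<close> is
  self-adjoint and \<open>1 - z k\<close> is invertible for all \<open>\<bar>z\<bar> \<le> 1\<close>, then \<open>\<parallel>k\<parallel> < 1\<close>
  (\<open>norm_self_adjoint_less_one\<close>). It has an elementary proof in the style of Rickart: averaging
  \<open>(1 - \<zeta> z k)\<^sup>-\<^sup>1\<close> over the \<open>n\<close>-th roots of unity \<open>\<zeta>\<close> gives \<open>(1 - (z k)\<^sup>n)\<^sup>-\<^sup>1\<close>, so by uniform continuity of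
  the resolvent on the unit disc, \<open>(1 - (z k)\<^sup>n)\<^sup>-\<^sup>1\<close> and \<open>(1 - (t z k)\<^sup>n)\<^sup>-\<^sup>1\<close> are close, uniformly in \<open>n\<close>,
  for \<open>t < 1\<close> close to \<open>1\<close>. If \<open>\<parallel>k\<parallel> \<ge> 1\<close> take \<open>\<bar>z\<bar> = 1/\<parallel>k\<parallel>\<close> and \<open>n = 2\<^sup>m\<close>: then
  \<open>\<parallel>(z k)\<^sup>n\<parallel> = 1\<close> for every \<open>m\<close>, while \<open>\<parallel>(t z k)\<^sup>n\<parallel> = t\<^sup>n\<close> tends to \<open>0\<close>, which is impossible.
\<close>

section \<open>Quasi-inverses and contractivity of star automorphisms\<close>

text \<open>
  In a unital ring this says \<open>(1 - x) * (1 + p) = 1 = (1 + p) * (1 - x)\<close>; the form below makes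
  sense in an algebra without a unit and is visibly preserved by ring homomorphisms.
\<close>

definition quasi_inverse :: "'a::ring \<Rightarrow> 'a \<Rightarrow> bool" where
  "quasi_inverse x p \<longleftrightarrow> p = x + x * p \<and> p = x + p * x"

text \<open>
  Instead of summing the Neumann series, solve the left and the right equation separately by
  Banach's fixed point theorem; associativity forces the two solutions to agree.
\<close>

lemma quasi_inverse_exists:
  fixes x :: "'a::{banach, real_normed_algebra}"
  assumes "norm x < 1"
  shows "\<exists>p. quasi_inverse x p"
proof -
  have lip: "dist (x + x * y) (x + x * z) \<le> norm x * dist y z"
    "dist (x + y * x) (x + z * x) \<le> norm x * dist y z" for y z
    using norm_mult_ineq[of x "y - z"] norm_mult_ineq[of "y - z" x]
    by (simp_all add: dist_norm algebra_simps)
  have "\<exists>!p\<in>UNIV. x + x * p = p"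
    by (rule Banach_fix[where c = "norm x"]) (use assms lip in \<open>auto intro: complete_UNIV\<close>)
  then obtain p where p: "x + x * p = p" by auto
  have "\<exists>!q\<in>UNIV. x + q * x = q"
    by (rule Banach_fix[where c = "norm x"]) (use assms lip in \<open>auto intro: complete_UNIV\<close>)
  then obtain q where q: "x + q * x = q" by auto
  have "q * p = q * x + q * x * p"
    by (metis p distrib_left mult.assoc)
  moreover have "q * p = x * p + q * x * p"
    by (metis q distrib_right)
  ultimately have "x * p = q * x" by simp
  then have "p = q" using p q by metis
  then show ?thesis unfolding quasi_inverse_def using p q by metis
qed

text \<open>
  The resolvent identity \<open>(1-x)\<^sup>-\<^sup>1 - (1-y)\<^sup>-\<^sup>1 = (1-x)\<^sup>-\<^sup>1 * (x - y) * (1-y)\<^sup>-\<^sup>1\<close>, with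
  \<open>(1-x)\<^sup>-\<^sup>1 = 1 + p\<close> and \<open>(1-y)\<^sup>-\<^sup>1 = 1 + q\<close> multiplied out.
\<close>

lemma quasi_inverse_diff:
  assumes "quasi_inverse x p" "quasi_inverse y q"
  shows "p - q = (x - y) + p * (x - y) + (x - y) * q + p * (x - y) * q"
proof -
  have px: "p * x = p - x" and yq: "y * q = q - y"
    using assms unfolding quasi_inverse_def by (metis add_diff_cancel_left')+
  have "p * x * q = p * q - x * q" unfolding px by (simp add: left_diff_distrib)
  moreover have "p * y * q = p * q - p * y"
    unfolding mult.assoc yq by (simp add: right_diff_distrib)
  ultimately show ?thesis using px yq by (simp add: left_diff_distrib right_diff_distrib)
qed

lemma norm_quasi_inverse_diff_le:
  fixes x :: "'a::real_normed_algebra"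
  assumes "quasi_inverse x p" "quasi_inverse y q"
  shows "norm (p - q) \<le> norm (x - y) * (1 + norm p) * (1 + norm q)"
proof -
  let ?d = "x - y"
  have 1: "norm (p * ?d) \<le> norm p * norm ?d" and 2: "norm (?d * q) \<le> norm ?d * norm q"
    by (rule norm_mult_ineq)+
  have 3: "norm (p * ?d * q) \<le> norm p * norm ?d * norm q"
    using norm_mult_ineq[of "p * ?d" q] 1 by (meson mult_right_mono norm_ge_zero order_trans)
  have "norm (p - q) \<le> norm ?d + norm (p * ?d) + norm (?d * q) + norm (p * ?d * q)"
    unfolding quasi_inverse_diff[OF assms] by (intro norm_triangle_le add_mono order_refl)
  also have "\<dots> \<le> norm ?d + norm p * norm ?d + norm ?d * norm q + norm p * norm ?d * norm q"
    using 1 2 3 by linarith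
  also have "\<dots> = norm ?d * (1 + norm p) * (1 + norm q)" by (simp add: algebra_simps)
  finally show ?thesis .
qed

text \<open>
  This is \<open>(1-x\<^sup>2)\<^sup>-\<^sup>1 = ((1-x)\<^sup>-\<^sup>1 + (1+x)\<^sup>-\<^sup>1) / 2\<close>. Iterating it replaces the average over the
  \<open>2\<^sup>m\<close>-th roots of unity.
\<close>

lemma quasi_inverse_square:
  fixes x :: "'a::real_algebra"
  assumes "quasi_inverse x p" "quasi_inverse (- x) q"
  shows "quasi_inverse (x * x) ((1/2) *\<^sub>R (p + q))"
proof -
  have xp: "x * p = p - x" and px: "p * x = p - x"
    using assms(1) unfolding quasi_inverse_def by (metis add_diff_cancel_left')+
  have xq: "x * q = - x - q" and qx: "q * x = - x - q"
    using assms(2) unfolding quasi_inverse_def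
    by (metis add_diff_cancel_left' minus_diff_eq mult_minus_left mult_minus_right
        diff_minus_eq_add minus_diff_commute uminus_add_conv_diff add.inverse_inverse)+
  have "x * x * p + x * x * q = p + q - 2 *\<^sub>R (x * x)"
    unfolding mult.assoc xp xq by (simp add: algebra_simps xp xq scaleR_2)
  then have "(1/2) *\<^sub>R (x * x * p + x * x * q) = (1/2) *\<^sub>R (p + q) - x * x"
    by (simp add: scaleR_diff_right)
  moreover have "p * (x * x) + q * (x * x) = p + q - 2 *\<^sub>R (x * x)"
    unfolding mult.assoc[symmetric] px qx by (simp add: algebra_simps px qx scaleR_2)
  then have "(1/2) *\<^sub>R (p * (x * x) + q * (x * x)) = (1/2) *\<^sub>R (p + q) - x * x"
    by (simp add: scaleR_diff_right)
  ultimately show ?thesis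
    unfolding quasi_inverse_def by (simp add: distrib_left distrib_right)
qed

text \<open>
  The resolvent identity bounds \<open>g w - g z\<close> by a product that still contains \<open>g w\<close>. Near \<open>z\<close> the
  same inequality first gives the a priori bound \<open>1 + \<parallel>g w\<parallel> \<le> 2 (1 + \<parallel>g z\<parallel>)\<close>.
\<close>

lemma continuous_on_quasi_inverse:
  fixes f g :: "'b::metric_space \<Rightarrow> 'a::real_normed_algebra"
  assumes cont: "continuous_on S f" and qi: "\<And>z. z \<in> S \<Longrightarrow> quasi_inverse (f z) (g z)"
  shows "continuous_on S g"
  unfolding continuous_on_def
proof
  fix z assume z: "z \<in> S"
  define c where "c = 1 + norm (g z)"
  have c: "c > 0" unfolding c_def by (simp add: add_pos_nonneg)
  have lim: "((\<lambda>w. norm (f z - f w)) \<longlongrightarrow> 0) (at z within S)"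
    using cont z unfolding continuous_on_def by (auto intro!: tendsto_eq_intros)
  have ev: "\<forall>\<^sub>F w in at z within S. norm (f z - f w) < 1 / (2 * c)"
    using lim c by (intro order_tendstoD(2)) auto
  have evS: "\<forall>\<^sub>F w in at z within S. w \<in> S"
    by (simp add: eventually_at_filter)
  have bnd: "\<forall>\<^sub>F w in at z within S. norm (g w - g z) \<le> norm (f z - f w) * (2 * c\<^sup>2)"
    using ev evS
  proof eventually_elim
    case (elim w)
    let ?e = "norm (f z - f w)"
    have le: "norm (g z - g w) \<le> ?e * c * (1 + norm (g w))"
      unfolding c_def by (rule norm_quasi_inverse_diff_le) (use qi z elim in auto)
    have "?e * c \<le> 1/2" using elim c by (simp add: field_simps)
    then have "?e * c * (1 + norm (g w)) \<le> 1/2 * (1 + norm (g w))"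
      by (intro mult_right_mono) auto
    then have "norm (g z - g w) \<le> 1/2 * (1 + norm (g w))"
      using le by linarith
    moreover have "norm (g w) \<le> norm (g z) + norm (g z - g w)"
      by (metis norm_minus_commute norm_triangle_sub)
    ultimately have "1 + norm (g w) \<le> 2 * c" unfolding c_def by simp
    then have "?e * c * (1 + norm (g w)) \<le> ?e * c * (2 * c)"
      using c by (intro mult_left_mono) auto
    then show ?case using le by (simp add: norm_minus_commute power2_eq_square mult_ac)
  qed
  have "((\<lambda>w. norm (f z - f w) * (2 * c\<^sup>2)) \<longlongrightarrow> 0) (at z within S)"
    using tendsto_mult_left_zero[OF lim] .
  then have "((\<lambda>w. g w - g z) \<longlongrightarrow> 0) (at z within S)"
    by (rule Lim_null_comparison[OF bnd])
  then show "(g \<longlongrightarrow> g z) (at z within S)"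
    by (simp add: Lim_null[of g])
qed

lemma scaleC_minus_one: "(- 1) *\<^sub>C x = - (x :: 'a::cstar_algebra)"
  using scaleC_of_real[of "- 1" x] by simp

lemma scaleC_diff_left: "(c - d) *\<^sub>C x = c *\<^sub>C x - d *\<^sub>C (x :: 'a::cstar_algebra)"
  by (metis add_diff_cancel diff_add_cancel scaleC_add_left)

text \<open>The power \<open>x ^ (2 ^ m)\<close>, by repeated squaring because an algebra without a unit has no \<open>x ^ 0\<close>.\<close>

abbreviation dyadic_power :: "nat \<Rightarrow> 'a::times \<Rightarrow> 'a" where
  "dyadic_power m \<equiv> (\<lambda>x. x * x) ^^ m"

lemma dyadic_power_scaleC:
  "dyadic_power m (c *\<^sub>C x) = c ^ (2 ^ m) *\<^sub>C dyadic_power m (x :: 'a::cstar_algebra)"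
proof (induction m)
  case (Suc m)
  then show ?case
    by (simp add: mult_scaleC_left mult_scaleC_right scaleC_scaleC mult_2 power_add)
qed simp

text \<open>
  Powers of a self-adjoint \<open>k\<close> are self-adjoint, so the C*-identity reads \<open>\<parallel>k\<^sup>2\<parallel> = \<parallel>k\<parallel>\<^sup>2\<close> for each of
  them: squaring loses no norm.
\<close>

lemma norm_dyadic_power_scaleC:
  fixes k :: "'a::cstar_algebra"
  assumes "star k = k"
  shows "norm (dyadic_power m (c *\<^sub>C k)) = (cmod c * norm k) ^ (2 ^ m)"
proof -
  have "star (dyadic_power m k) = dyadic_power m k \<and> norm (dyadic_power m k) = norm k ^ (2 ^ m)"
  proof (induction m)
    case (Suc m)
    then show ?case
      using cstar_identity[of "dyadic_power m k"]
      by (simp add: star_mult power_mult[symmetric] mult.commute)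
  qed (use assms in simp)
  then show ?thesis
    by (simp add: dyadic_power_scaleC norm_scaleC norm_power power_mult_distrib)
qed

text \<open>
  Averaging does not increase distances. The hypothesis is about a whole circle because passing
  from \<open>m\<close> to \<open>m + 1\<close> uses the point \<open>\<omega> z\<close> with \<open>\<omega>\<close> a \<open>2\<^sup>m\<close>-th root of \<open>-1\<close>, for which
  \<open>(\<omega> z k) ^ (2 ^ m) = - (z k) ^ (2 ^ m)\<close>. The bound does not depend on \<open>m\<close>.
\<close>

lemma dyadic_quasi_inverses_close:
  fixes k :: "'a::cstar_algebra"
  assumes close: "\<And>z. cmod z = \<rho> \<Longrightarrow> \<exists>p q. quasi_inverse (z *\<^sub>C k) p \<and>
     quasi_inverse ((t * z) *\<^sub>C k) q \<and> norm (p - q) \<le> e"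
  shows "cmod z = \<rho> \<Longrightarrow> \<exists>p q. quasi_inverse (dyadic_power m (z *\<^sub>C k)) p \<and>
     quasi_inverse (dyadic_power m ((t * z) *\<^sub>C k)) q \<and> norm (p - q) \<le> e"
proof (induction m arbitrary: z)
  case 0
  then show ?case using close by simp
next
  case (Suc m)
  define \<omega> where "\<omega> = cis (pi / 2 ^ m)"
  have \<omega>: "\<omega> ^ (2 ^ m) = - 1"
    unfolding \<omega>_def Complex.DeMoivre by simp
  have minus: "dyadic_power m ((\<omega> * y) *\<^sub>C k) = - dyadic_power m (y *\<^sub>C k)" for y
    unfolding dyadic_power_scaleC power_mult_distrib \<omega>
    using scaleC_scaleC[of "- 1" "y ^ (2 ^ m)" "dyadic_power m k"] by (simp add: scaleC_minus_one)
  obtain p q where pq: "quasi_inverse (dyadic_power m (z *\<^sub>C k)) p"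
     "quasi_inverse (dyadic_power m ((t * z) *\<^sub>C k)) q" "norm (p - q) \<le> e"
    using Suc by blast
  have "cmod (\<omega> * z) = \<rho>" using Suc.prems by (simp add: \<omega>_def norm_mult)
  then obtain p' q' where pq': "quasi_inverse (dyadic_power m ((\<omega> * z) *\<^sub>C k)) p'"
     "quasi_inverse (dyadic_power m ((t * (\<omega> * z)) *\<^sub>C k)) q'" "norm (p' - q') \<le> e"
    using Suc.IH by blast
  have "quasi_inverse (dyadic_power (Suc m) (z *\<^sub>C k)) ((1/2) *\<^sub>R (p + p'))"
    using quasi_inverse_square[OF pq(1)] pq'(1) by (simp add: minus)
  moreover have "quasi_inverse (dyadic_power (Suc m) ((t * z) *\<^sub>C k)) ((1/2) *\<^sub>R (q + q'))"
    using quasi_inverse_square[OF pq(2)] pq'(2) minus[of "t * z"]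
    by (simp add: mult.left_commute)
  moreover have "norm ((1/2) *\<^sub>R (p + p') - (1/2) *\<^sub>R (q + q')) \<le> e"
  proof -
    have "(1/2) *\<^sub>R (p + p') - (1/2) *\<^sub>R (q + q') = (1/2) *\<^sub>R ((p - q) + (p' - q'))"
      by (simp add: algebra_simps)
    then show ?thesis
      using norm_triangle_ineq[of "p - q" "p' - q'"] pq(3) pq'(3) by simp
  qed
  ultimately show ?case by blast
qed

text \<open>
  If \<open>\<parallel>k\<parallel> \<ge> 1\<close>, put \<open>r = 1/\<parallel>k\<parallel>\<close> and choose \<open>t < 1\<close> so close to \<open>1\<close> that the quasi-inverses at \<open>z\<close> and
  \<open>t z\<close> differ by at most \<open>1/4\<close> on the circle of radius \<open>r\<close>. The same then holds for those of the
  powers \<open>u = (r k) ^ (2 ^ n)\<close> and \<open>v = (t r k) ^ (2 ^ n)\<close>. But \<open>\<parallel>u\<parallel> = 1\<close> forces its quasi-inverse to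
  have norm at least \<open>1/2\<close>, and \<open>\<parallel>v\<parallel> < 1/8\<close> forces that of \<open>v\<close> to have norm below \<open>1/7\<close>.
\<close>

lemma norm_self_adjoint_less_one:
  fixes k :: "'a::cstar_algebra"
  assumes sa: "star k = k"
    and ex: "\<And>z. cmod z \<le> 1 \<Longrightarrow> \<exists>p. quasi_inverse (z *\<^sub>C k) p"
  shows "norm k < 1"
proof (rule ccontr)
  assume "\<not> norm k < 1"
  then have k: "norm k \<ge> 1" by simp
  obtain p where p: "\<And>z. cmod z \<le> 1 \<Longrightarrow> quasi_inverse (z *\<^sub>C k) (p z)"
    using ex by metis
  have "(norm k)-lipschitz_on (cball 0 1) (\<lambda>z. z *\<^sub>C k)"
    by (rule lipschitz_onI) (simp_all add: dist_norm scaleC_diff_left[symmetric] norm_scaleC)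
  then have "continuous_on (cball 0 1) (\<lambda>z. z *\<^sub>C k)"
    by (rule lipschitz_on_continuous_on)
  then have "continuous_on (cball 0 1) p"
    by (rule continuous_on_quasi_inverse) (use p in simp)
  then have "uniformly_continuous_on (cball 0 1) p"
    by (intro compact_uniformly_continuous compact_cball)
  then obtain d where d: "d > 0" and unif: "\<And>z w. cmod z \<le> 1 \<Longrightarrow> cmod w \<le> 1 \<Longrightarrow>
      dist w z < d \<Longrightarrow> dist (p w) (p z) < 1/4"
    unfolding uniformly_continuous_on_def
    by (metis (no_types, lifting) zero_less_divide_1_iff zero_less_numeral mem_cball_0)
  define r where "r = 1 / norm k"
  have r: "0 < r" "r \<le> 1" "r * norm k = 1" using k by (auto simp: r_def divide_simps)
  define t where "t = max (1/2) (1 - d/2)"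
  have t: "0 < t" "t < 1" "1 - t < d" using d by (auto simp: t_def)
  have close: "\<exists>p q. quasi_inverse (z *\<^sub>C k) p \<and>
     quasi_inverse ((complex_of_real t * z) *\<^sub>C k) q \<and> norm (p - q) \<le> 1/4" if z: "cmod z = r" for z
  proof -
    have le: "cmod z \<le> 1" "cmod (t * z) \<le> 1"
      using z r t by (auto simp: norm_mult mult_le_one)
    have "z - t * z = complex_of_real (1 - t) * z" by (simp add: algebra_simps)
    then have "dist z (t * z) = (1 - t) * r"
      using z t by (simp add: dist_norm norm_mult del: of_real_diff)
    also have "\<dots> \<le> 1 - t" using r t by (simp add: mult_left_le)
    finally have "dist (p z) (p (t * z)) < 1/4" using unif le t by simp
    then show ?thesis using p le by (metis dist_norm less_imp_le)
  qed
  obtain n where n: "t ^ n < 1/8"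
    using real_arch_pow_inv[of "1/8" t] t by auto
  have "t ^ (2 ^ n) \<le> t ^ n"
    using t by (intro power_decreasing) (auto intro: less_imp_le)
  then have tn: "t ^ (2 ^ n) < 1/8" using n by simp
  define u where "u = dyadic_power n (complex_of_real r *\<^sub>C k)"
  define v where "v = dyadic_power n ((complex_of_real t * complex_of_real r) *\<^sub>C k)"
  have nu: "norm u = 1"
    using r by (simp add: u_def norm_dyadic_power_scaleC[OF sa])
  have "cmod (complex_of_real t * complex_of_real r) * norm k = t"
    using r t by (simp add: norm_mult)
  then have nv: "norm v < 1/8"
    using tn unfolding v_def norm_dyadic_power_scaleC[OF sa] by simp
  obtain a b where ab: "quasi_inverse u a" "quasi_inverse v b" "norm (a - b) \<le> 1/4"
    using dyadic_quasi_inverses_close[OF close, of r "complex_of_real r" n] r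
    unfolding u_def v_def by auto
  have "u = a - u * a" "b = v + v * b"
    using ab unfolding quasi_inverse_def by (simp_all add: algebra_simps)
  then have "1 \<le> norm a + norm (u * a)" "norm b \<le> norm v + norm (v * b)"
    using nu by (metis norm_triangle_ineq4, metis norm_triangle_ineq)
  moreover have "norm (u * a) \<le> norm a" using norm_mult_ineq[of u a] nu by simp
  moreover have "norm (v * b) \<le> 1/8 * norm b"
    using norm_mult_ineq[of v b] nv by (meson less_imp_le mult_right_mono norm_ge_zero order_trans)
  moreover have "norm a \<le> norm b + norm (a - b)" by (rule norm_triangle_sub)
  ultimately show False using nv ab(3) by linarith
qed

lemma star_automorphism_diff:
  assumes "star_automorphism \<phi>"
  shows "\<phi> (x - y) = \<phi> x - \<phi> y"
  using assms unfolding star_automorphism_def by (metis add_diff_cancel diff_add_cancel)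

text \<open>
  Otherwise rescale \<open>h\<close> to \<open>g\<close> with \<open>\<parallel>g\<parallel> < 1 = \<parallel>\<phi> g\<parallel>\<close>. All \<open>z g\<close> with \<open>\<bar>z\<bar> \<le> 1\<close> have quasi-inverses, and
  \<open>\<phi>\<close> carries them to quasi-inverses of \<open>z (\<phi> g)\<close>, which forces \<open>\<parallel>\<phi> g\<parallel> < 1\<close>.
\<close>

lemma norm_star_automorphism_self_adjoint:
  assumes aut: "star_automorphism \<phi>" and sa: "star h = h"
  shows "norm (\<phi> h) \<le> norm h"
proof (rule ccontr)
  assume "\<not> norm (\<phi> h) \<le> norm h"
  then have lt: "norm h < norm (\<phi> h)" by simp
  have hom: "\<phi> (x + y) = \<phi> x + \<phi> y" "\<phi> (c *\<^sub>C x) = c *\<^sub>C \<phi> x" "\<phi> (x * y) = \<phi> x * \<phi> y"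
    "\<phi> (star x) = star (\<phi> x)" for x y c
    using aut unfolding star_automorphism_def by blast+
  have pos: "norm (\<phi> h) > 0" using lt norm_ge_zero[of h] by linarith
  define g where "g = complex_of_real (1 / norm (\<phi> h)) *\<^sub>C h"
  have "norm g < 1" unfolding g_def norm_scaleC norm_of_real using lt pos by (simp add: field_simps)
  have "star (\<phi> g) = \<phi> g"
    unfolding hom(4)[symmetric] g_def star_scaleC sa by simp
  then have "norm (\<phi> g) < 1"
  proof (rule norm_self_adjoint_less_one)
    fix z :: complex assume "cmod z \<le> 1"
    then have "norm (z *\<^sub>C g) < 1"
      using \<open>norm g < 1\<close> unfolding norm_scaleC
      by (meson le_less_trans mult_left_le_one_le norm_ge_zero)
    then obtain q where "quasi_inverse (z *\<^sub>C g) q" using quasi_inverse_exists by blast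
    then have "quasi_inverse (z *\<^sub>C \<phi> g) (\<phi> q)"
      unfolding quasi_inverse_def by (metis hom(1-3))
    then show "\<exists>p. quasi_inverse (z *\<^sub>C \<phi> g) p" by blast
  qed
  moreover have "norm (\<phi> g) = 1"
    unfolding g_def hom norm_scaleC using pos by (simp add: norm_divide)
  ultimately show False by simp
qed

lemma norm_star_automorphism_le:
  assumes aut: "star_automorphism \<phi>"
  shows "norm (\<phi> x) \<le> norm x"
proof -
  have "(norm (\<phi> x))\<^sup>2 = norm (\<phi> (star x * x))"
    using aut unfolding star_automorphism_def by (metis cstar_identity)
  also have "\<dots> \<le> norm (star x * x)"
    by (rule norm_star_automorphism_self_adjoint[OF aut]) (simp add: star_mult star_star)
  also have "\<dots> = (norm x)\<^sup>2" by (rule cstar_identity)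
  finally show ?thesis by (simp add: power2_le_iff_abs_le)
qed

section \<open>Integrable uniformly continuous functions\<close>

lemma open_translate:
  fixes U :: "'g::topological_group_add set"
  assumes "open U"
  shows "open ((\<lambda>t. s + t) ` U)"
proof -
  have "(\<lambda>t. s + t) ` U = (\<lambda>x. - s + x) -` U"
    by (auto simp: image_iff add.assoc[symmetric]) (metis add.assoc add_minus_cancel)
  moreover have "open ((\<lambda>x. - s + x) -` U)"
    by (intro open_vimage assms continuous_intros)
  ultimately show ?thesis by simp
qed

text \<open>
  If \<open>W\<close> were null, so would be every compact set, being covered by finitely many translates of
  \<open>W\<close>; inner regularity would make the whole measure zero.
\<close>

lemma left_haar_measure_open_pos:
  fixes \<mu> :: "'g::{topological_group_add, t2_space} measure"
  assumes haar: "left_haar_measure \<mu>" and W: "open W" "0 \<in> W"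
  shows "emeasure \<mu> W > 0"
proof (rule ccontr)
  assume "\<not> emeasure \<mu> W > 0"
  then have W0: "emeasure \<mu> W = 0" by simp
  note haarD = haar[unfolded left_haar_measure_def]
  note sets = haarD[THEN conjunct1]
  note nz = haarD[THEN conjunct2, THEN conjunct1]
  note inv = haarD[THEN conjunct2, THEN conjunct2, THEN conjunct1, rule_format]
  note inner = haarD[THEN conjunct2, THEN conjunct2, THEN conjunct2, THEN conjunct2, THEN conjunct2,
      rule_format]
  have "emeasure \<mu> K = 0" if K: "compact K" for K
  proof -
    have "K \<subseteq> (\<Union>s\<in>K. (\<lambda>t. s + t) ` W)" using W(2) by force
    then obtain F where F: "finite F" "K \<subseteq> (\<Union>s\<in>F. (\<lambda>t. s + t) ` W)"
      using compactE_image[OF K, of K "\<lambda>s. (\<lambda>t. s + t) ` W"] open_translate[OF W(1)] by metis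
    have "emeasure \<mu> K \<le> emeasure \<mu> (\<Union>s\<in>F. (\<lambda>t. s + t) ` W)"
      by (rule emeasure_mono[OF F(2)]) (auto simp: sets intro!: borel_open open_UN open_translate W)
    also have "\<dots> \<le> (\<Sum>s\<in>F. emeasure \<mu> ((\<lambda>t. s + t) ` W))"
      by (rule emeasure_subadditive_finite)
        (use F in \<open>auto simp: sets intro!: borel_open open_translate W\<close>)
    also have "\<dots> = 0" using inv[OF borel_open[OF W(1)]] W0 by simp
    finally show ?thesis by simp
  qed
  then have "(SUP K\<in>{K. compact K \<and> K \<subseteq> UNIV}. emeasure \<mu> K) \<le> 0" by (intro SUP_least) auto
  then have "emeasure \<mu> UNIV = 0" using inner[OF open_UNIV] by simp
  with nz show False by simp
qed

text \<open>
  The packing argument: the points of \<open>S\<close> below lie in \<open>\<parallel>f\<parallel> \<ge> e\<close> and have disjoint translates of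
  \<open>W\<close>. The next point is taken outside the compact union of the sets \<open>s + K - K\<close>, where \<open>K\<close> is a
  compact set containing \<open>W\<close>, so that its translate meets none of the previous ones.
\<close>

lemma integrable_imp_vanishes_at_infinity:
  fixes \<mu> :: "'g::{topological_group_add, t2_space} measure"
    and f :: "'g \<Rightarrow> 'b::real_normed_vector"
  assumes lc: "locally_compact_space (euclidean :: 'g topology)"
    and haar: "left_haar_measure \<mu>"
    and fin: "(\<integral>\<^sup>+s. ennreal (norm (f s)) \<partial>\<mu>) < \<infinity>"
    and unif: "\<And>e. e > 0 \<Longrightarrow> \<forall>\<^sub>F v in nhds 0. \<forall>s. norm (f (s + v) - f s) \<le> e"
  shows "vanishes_at_infinity f"
  unfolding vanishes_at_infinity_def
proof (intro allI impI, rule ccontr)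
  fix e :: real assume e: "e > 0"
    and "\<not> (\<exists>K. compact K \<and> (\<forall>s. s \<notin> K \<longrightarrow> norm (f s) < e))"
  then have far: "\<exists>s. s \<notin> K \<and> norm (f s) \<ge> e" if "compact K" for K
    using that by (meson not_le)
  obtain U0 K :: "'g set" where UK: "open U0" "compact K" "0 \<in> U0" "U0 \<subseteq> K"
    using lc unfolding locally_compact_space_def by (simp add: compactin_euclidean_iff) metis
  obtain V where V: "open V" "0 \<in> V" "\<And>v s. v \<in> V \<Longrightarrow> norm (f (s + v) - f s) \<le> e/2"
    using unif[of "e/2"] e unfolding eventually_nhds by auto
  define W where "W = U0 \<inter> V"
  have W: "open W" "0 \<in> W" "W \<subseteq> K" "\<And>v s. v \<in> W \<Longrightarrow> norm (f (s + v) - f s) \<le> e/2"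
    using UK V by (auto simp: W_def)
  define tr where "tr s = (\<lambda>t. s + t) ` W" for s
  note haarD = haar[unfolded left_haar_measure_def]
  note sets = haarD[THEN conjunct1]
  have inv: "emeasure \<mu> (tr s) = emeasure \<mu> W" for s
    unfolding tr_def
    by (rule haarD[THEN conjunct2, THEN conjunct2, THEN conjunct1, rule_format, OF borel_open[OF W(1)]])
  have tr_sets: "tr s \<in> sets \<mu>" for s
    using open_translate[OF W(1)] by (simp add: tr_def sets borel_open)
  have packing: "\<exists>S. finite S \<and> card S = n \<and> (\<forall>s\<in>S. norm (f s) \<ge> e) \<and> disjoint_family_on tr S" for n
  proof (induction n)
    case 0
    then show ?case by (auto simp: disjoint_family_on_def)
  next
    case (Suc n)
    then obtain S where S: "finite S" "card S = n" "\<forall>s\<in>S. norm (f s) \<ge> e" "disjoint_family_on tr S"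
      by blast
    define L where "L = (\<Union>s\<in>S. (\<lambda>(x, y). s + x - y) ` (K \<times> K))"
    have "compact ((\<lambda>(x, y). s + x - y) ` (K \<times> K))" for s
      unfolding diff_conv_add_uminus case_prod_beta
      by (intro compact_continuous_image compact_Times UK continuous_intros)
    then have "compact L" unfolding L_def using S(1) by (intro compact_UN) auto
    then obtain s' where s': "s' \<notin> L" "norm (f s') \<ge> e" using far by blast
    have disj: "tr s \<inter> tr s' = {}" if "s \<in> S" for s
    proof (rule ccontr)
      assume "tr s \<inter> tr s' \<noteq> {}"
      then obtain x y where xy: "x \<in> W" "y \<in> W" "s + x = s' + y" unfolding tr_def by auto
      then have "s' = s + x - y" by (simp add: eq_diff_eq)
      then show False using s'(1) that xy W(3) unfolding L_def by force
    qed
    have "s' \<notin> S"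
      using disj[of s'] W(2) by (auto simp: tr_def)
    moreover have "disjoint_family_on tr (insert s' S)"
      using disj S(4) unfolding disjoint_family_on_def by (metis insert_iff inf_commute)
    ultimately show ?case
      using S s' by (intro exI[of _ "insert s' S"]) auto
  qed
  define c where "c = ennreal (e/2) * emeasure \<mu> W"
  have c: "c > 0"
    unfolding c_def using left_haar_measure_open_pos[OF haar W(1,2)] e
    by (simp add: ennreal_zero_less_mult_iff)
  have le: "of_nat n * c \<le> (\<integral>\<^sup>+s. ennreal (norm (f s)) \<partial>\<mu>)" for n
  proof -
    obtain S where S: "finite S" "card S = n" "\<forall>s\<in>S. norm (f s) \<ge> e" "disjoint_family_on tr S"
      using packing by blast
    have ge: "e \<le> norm (f x) * 2" if x: "x \<in> tr s" "s \<in> S" for x s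
    proof -
      obtain v where "v \<in> W" "x = s + v" using x unfolding tr_def by auto
      then have "norm (f x - f s) \<le> e/2" using W(4) by simp
      moreover have "norm (f s) \<le> norm (f x) + norm (f x - f s)"
        by (metis norm_minus_commute norm_triangle_sub)
      ultimately show ?thesis using S(3) x by force
    qed
    have "of_nat n * c = (\<Sum>s\<in>S. ennreal (e/2) * emeasure \<mu> (tr s))"
      by (simp add: inv S(2) c_def)
    also have "\<dots> = ennreal (e/2) * emeasure \<mu> (\<Union>s\<in>S. tr s)"
      unfolding sum_distrib_left[symmetric]
      by (subst sum_emeasure) (use S tr_sets in auto)
    also have "\<dots> = (\<integral>\<^sup>+x. ennreal (e/2) * indicator (\<Union>s\<in>S. tr s) x \<partial>\<mu>)"
      by (rule nn_integral_cmult_indicator[symmetric]) (use S tr_sets in auto)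
    also have "\<dots> \<le> (\<integral>\<^sup>+x. ennreal (norm (f x)) \<partial>\<mu>)"
      by (rule nn_integral_mono) (use ge in \<open>auto simp: indicator_def intro!: ennreal_leI\<close>)
    finally show ?thesis .
  qed
  obtain b where b: "(\<integral>\<^sup>+s. ennreal (norm (f s)) \<partial>\<mu>) = ennreal b" "b \<ge> 0"
    using fin by (cases "\<integral>\<^sup>+s. ennreal (norm (f s)) \<partial>\<mu>") auto
  obtain c' where c': "c = ennreal c'" "c' > 0"
  proof (cases c)
    case (real r)
    then show ?thesis using c that by auto
  next
    case top
    then show ?thesis using le[of 1] b by (simp add: top_unique)
  qed
  obtain n :: nat where "real n * c' > b" using reals_Archimedean3[OF c'(2)] by blast
  moreover have "ennreal (real n * c') \<le> ennreal b"
    using le[of n] b c' by (simp add: ennreal_mult ennreal_of_nat_eq_real_of_nat)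
  then have "real n * c' \<le> b" using b by (simp add: ennreal_le_iff)
  ultimately show False by simp
qed

text \<open>
  In a target that is not second countable, differences of measurable functions need not be
  measurable. So additivity of the integral is not applied to \<open>\<parallel>f\<parallel> \<le> \<parallel>f - h i\<parallel> + \<parallel>h i\<parallel>\<close> but to the
  decomposition of \<open>\<parallel>f\<parallel>\<close> into real functions built from \<open>\<parallel>f\<parallel>\<close> and \<open>\<parallel>h i\<parallel>\<close>, where
  \<open>ennreal\<close> truncates the difference \<open>\<parallel>f\<parallel> - \<parallel>h i\<parallel>\<close> at \<open>0\<close>.
\<close>

lemma bochner_integrable_norm_finite:
  assumes "bochner_integrable M f"
  shows "(\<integral>\<^sup>+x. ennreal (norm (f x)) \<partial>M) < \<infinity>"
proof -
  obtain h where meas: "f \<in> borel_measurable M"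
    and simple: "\<And>i::nat. Bochner_Integration.simple_bochner_integrable M (h i)"
    and lim: "(\<lambda>i. \<integral>\<^sup>+x. ennreal (norm (f x - h i x)) \<partial>M) \<longlonglongrightarrow> 0"
    using assms unfolding bochner_integrable_def by blast
  have "\<forall>\<^sub>F i in sequentially. (\<integral>\<^sup>+x. ennreal (norm (f x - h i x)) \<partial>M) < \<infinity>"
    using order_tendstoD(2)[OF lim, of \<infinity>] by simp
  then obtain i where i: "(\<integral>\<^sup>+x. ennreal (norm (f x - h i x)) \<partial>M) < \<infinity>"
    using eventually_happens'[OF sequentially_bot] by blast
  have mf: "(\<lambda>x. norm (f x)) \<in> borel_measurable M"
    by (rule measurable_compose[OF meas]) (intro borel_measurable_continuous_onI continuous_intros)
  have sh: "Bochner_Integration.simple_bochner_integrable M (\<lambda>x. norm (h i x))"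
    by (rule simple_bochner_integrable_compose2[of "\<lambda>x y. norm x", OF _ simple simple]) simp
  have mh: "(\<lambda>x. norm (h i x)) \<in> borel_measurable M"
    using sh by (auto simp: simple_bochner_integrable.simps intro: borel_measurable_simple_function)
  have hfin: "(\<integral>\<^sup>+x. ennreal (norm (h i x)) \<partial>M) < \<infinity>"
    using has_bochner_integral_implies_finite_norm[OF
        has_bochner_integral_simple_bochner_integrable[OF sh]] by simp
  have "(\<integral>\<^sup>+x. ennreal (norm (f x)) \<partial>M) \<le>
      (\<integral>\<^sup>+x. ennreal (norm (f x) - norm (h i x)) + ennreal (norm (h i x)) \<partial>M)"
    by (rule nn_integral_mono) (simp add: ennreal_plus_if ennreal_leI max_def del: ennreal_plus)
  also have "\<dots> = (\<integral>\<^sup>+x. ennreal (norm (f x) - norm (h i x)) \<partial>M) + (\<integral>\<^sup>+x. ennreal (norm (h i x)) \<partial>M)"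
    by (rule nn_integral_add) (use mf mh in measurable)
  also have "\<dots> < \<infinity>"
  proof -
    have "(\<integral>\<^sup>+x. ennreal (norm (f x) - norm (h i x)) \<partial>M) \<le>
        (\<integral>\<^sup>+x. ennreal (norm (f x - h i x)) \<partial>M)"
      by (intro nn_integral_mono ennreal_leI norm_triangle_ineq2)
    also note i
    finally show ?thesis using hfin by (simp add: infinity_ennreal_def)
  qed
  finally show ?thesis .
qed

lemma vanishes_at_infinity_approx:
  assumes "\<And>e. e > 0 \<Longrightarrow> \<exists>g. vanishes_at_infinity g \<and> (\<forall>s. norm (f s - g s) \<le> e)"
  shows "vanishes_at_infinity f"
  unfolding vanishes_at_infinity_def
proof (intro allI impI)
  fix e :: real assume e: "e > 0"
  obtain g where g: "vanishes_at_infinity g" "\<And>s. norm (f s - g s) \<le> e/2"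
    using assms[of "e/2"] e by auto
  obtain K where K: "compact K" "\<And>s. s \<notin> K \<Longrightarrow> norm (g s) < e/2"
    using g(1) e unfolding vanishes_at_infinity_def by (meson half_gt_zero)
  have "norm (f s) < e" if "s \<notin> K" for s
    using norm_triangle_sub[of "f s" "g s"] g(2)[of s] K(2)[OF that] by linarith
  then show "\<exists>K. compact K \<and> (\<forall>s. s \<notin> K \<longrightarrow> norm (f s) < e)" using K(1) by blast
qed

section \<open>Properness of actions with integrable orbit functions\<close>

lemma dense_approx:
  fixes A :: "'a::real_normed_vector set"
  assumes "closure A = UNIV" "e > 0"
  obtains x where "x \<in> A" "norm (a - x) < e"
  using assms closure_approachable[of a A] by (metis UNIV_I dist_norm norm_minus_commute)

text \<open>
  As \<open>\<alpha>\<^sub>s\<close> is contractive, \<open>\<alpha>\<^bsub>s+v\<^esub> a - \<alpha>\<^sub>s a = \<alpha>\<^sub>s (\<alpha>\<^sub>v a - a)\<close> is controlled by continuity at \<open>0\<close> alone.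
\<close>

lemma cstar_action_uniformly_continuous:
  assumes act: "cstar_action \<alpha>" and e: "e > 0"
  shows "\<forall>\<^sub>F v in nhds 0. \<forall>s. norm (\<alpha> (s + v) a - \<alpha> s a) \<le> e"
proof -
  have aut: "star_automorphism (\<alpha> s)" and comp: "\<alpha> (s + t) x = \<alpha> s (\<alpha> t x)"
    and cont: "continuous_on UNIV (\<lambda>s. \<alpha> s a)" for s t x
    using act unfolding cstar_action_def by auto
  have "inj (\<alpha> 0)" using aut unfolding star_automorphism_def by (simp add: bij_def)
  \<comment> \<open>an injective idempotent map is the identity\<close>
  moreover have "\<alpha> 0 (\<alpha> 0 a) = \<alpha> 0 a" using comp[of 0 0 a] by simp
  ultimately have zero: "\<alpha> 0 a = a" by (meson injD)
  have "((\<lambda>v. \<alpha> v a) \<longlongrightarrow> \<alpha> 0 a) (at 0)"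
    using cont unfolding continuous_on_def by blast
  then have "((\<lambda>v. \<alpha> v a) \<longlongrightarrow> \<alpha> 0 a) (nhds 0)"
    by (rule tendsto_at_iff_tendsto_nhds[THEN iffD1])
  then have "\<forall>\<^sub>F v in nhds 0. norm (\<alpha> v a - a) < e"
    using e unfolding zero tendsto_iff dist_norm by blast
  then show ?thesis
  proof eventually_elim
    case (elim v)
    show ?case
    proof
      fix s
      have "norm (\<alpha> (s + v) a - \<alpha> s a) = norm (\<alpha> s (\<alpha> v a - a))"
        by (simp add: comp star_automorphism_diff[OF aut])
      also have "\<dots> \<le> norm (\<alpha> v a - a)" by (rule norm_star_automorphism_le[OF aut])
      finally show "norm (\<alpha> (s + v) a - \<alpha> s a) \<le> e" using elim by linarith
    qed
  qed
qed

text \<open>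
  Common to both notions of properness: \<open>T\<close> is right multiplication by a fixed element in the
  strong case, and a functional in the weak case.
\<close>

lemma bounded_linear_orbit_vanishes:
  fixes \<mu> :: "'g::{topological_group_add, t2_space} measure"
    and \<alpha> :: "'g \<Rightarrow> 'a::cstar_algebra \<Rightarrow> 'a"
    and T :: "'a \<Rightarrow> 'b::real_normed_vector"
  assumes lc: "locally_compact_space (euclidean :: 'g topology)"
    and haar: "left_haar_measure \<mu>" and act: "cstar_action \<alpha>" and T: "bounded_linear T"
    and dense: "closure A\<^sub>0 = UNIV"
    and fin: "\<And>a. a \<in> A\<^sub>0 \<Longrightarrow> (\<integral>\<^sup>+s. ennreal (norm (T (\<alpha> s a))) \<partial>\<mu>) < \<infinity>"
  shows "vanishes_at_infinity (\<lambda>s. T (\<alpha> s a))"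
proof -
  have aut: "star_automorphism (\<alpha> s)" for s
    using act unfolding cstar_action_def by blast
  obtain B where B: "B > 0" "\<And>x. norm (T x) \<le> norm x * B"
    using bounded_linear.pos_bounded[OF T] by blast
  have van: "vanishes_at_infinity (\<lambda>s. T (\<alpha> s b))" if b: "b \<in> A\<^sub>0" for b
  proof (rule integrable_imp_vanishes_at_infinity[OF lc haar fin[OF b]])
    fix e :: real assume e: "e > 0"
    have "\<forall>\<^sub>F v in nhds 0. \<forall>s. norm (\<alpha> (s + v) b - \<alpha> s b) \<le> e / B"
      using e B by (intro cstar_action_uniformly_continuous act) simp
    then show "\<forall>\<^sub>F v in nhds 0. \<forall>s. norm (T (\<alpha> (s + v) b) - T (\<alpha> s b)) \<le> e"
    proof eventually_elim
      case (elim v)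
      then have "norm (\<alpha> (s + v) b - \<alpha> s b) * B \<le> e" for s
        using B by (simp add: pos_le_divide_eq)
      then show ?case
        unfolding linear_diff[OF bounded_linear.linear[OF T], symmetric] using B(2) order_trans by blast
    qed
  qed
  show ?thesis
  proof (rule vanishes_at_infinity_approx)
    fix e :: real assume e: "e > 0"
    obtain b where b: "b \<in> A\<^sub>0" "norm (a - b) < e / B"
      using dense_approx[OF dense, of "e / B" a] e B by auto
    have "norm (T (\<alpha> s a) - T (\<alpha> s b)) \<le> e" for s
    proof -
      have "norm (T (\<alpha> s a) - T (\<alpha> s b)) \<le> norm (\<alpha> s (a - b)) * B"
        unfolding linear_diff[OF bounded_linear.linear[OF T], symmetric] star_automorphism_diff[OF aut] by (rule B)
      also have "\<dots> \<le> norm (a - b) * B"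
        using B norm_star_automorphism_le[OF aut] by (intro mult_right_mono) auto
      also have "\<dots> \<le> e" using b B by (simp add: field_simps)
      finally show ?thesis .
    qed
    then show "\<exists>g. vanishes_at_infinity g \<and> (\<forall>s. norm (T (\<alpha> s a) - g s) \<le> e)"
      using van[OF b(1)] by blast
  qed
qed

theorem corollary5p1:
  fixes \<mu> :: "'g::{topological_group_add, t2_space} measure"
    and \<alpha> :: "'g \<Rightarrow> 'a::cstar_algebra \<Rightarrow> 'a"
  assumes "locally_compact_space (euclidean :: 'g topology)"
    and "left_haar_measure \<mu>"
    and "cstar_action \<alpha>"
  shows "((\<exists>A\<^sub>0. closure A\<^sub>0 = UNIV \<and> action_invariant \<alpha> A\<^sub>0 \<and>
             (\<forall>a\<in>A\<^sub>0. \<forall>b\<in>A\<^sub>0. bochner_integrable \<mu> (\<lambda>s. \<alpha> s a * b)))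
           \<longrightarrow> s_proper \<alpha>) \<and>
         ((\<exists>A\<^sub>0. closure A\<^sub>0 = UNIV \<and> action_invariant \<alpha> A\<^sub>0 \<and>
             (\<forall>a\<in>A\<^sub>0. \<forall>\<omega>. dual_element \<omega> \<longrightarrow> integrable \<mu> (\<lambda>s. \<omega> (\<alpha> s a))))
           \<longrightarrow> w_proper \<alpha>)"
proof (intro conjI impI)
  assume "\<exists>A\<^sub>0. closure A\<^sub>0 = UNIV \<and> action_invariant \<alpha> A\<^sub>0 \<and>
    (\<forall>a\<in>A\<^sub>0. \<forall>b\<in>A\<^sub>0. bochner_integrable \<mu> (\<lambda>s. \<alpha> s a * b))"
  then obtain A\<^sub>0 where dense: "closure A\<^sub>0 = UNIV"
    and int: "\<And>a b. a \<in> A\<^sub>0 \<Longrightarrow> b \<in> A\<^sub>0 \<Longrightarrow> bochner_integrable \<mu> (\<lambda>s. \<alpha> s a * b)"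
    by blast
  show "s_proper \<alpha>"
    unfolding s_proper_def
  proof (intro allI)
    fix a b
    \<comment> \<open>a general left factor, but the right factor still in the dense set\<close>
    have van: "vanishes_at_infinity (\<lambda>s. \<alpha> s a * c)" if "c \<in> A\<^sub>0" for c
      by (rule bounded_linear_orbit_vanishes[OF assms bounded_linear_mult_left dense])
        (use int that bochner_integrable_norm_finite in blast)
    show "vanishes_at_infinity (\<lambda>s. \<alpha> s a * b)"
    proof (rule vanishes_at_infinity_approx)
      fix e :: real assume e: "e > 0"
      define C where "C = norm a + 1"
      have C: "C > 0" unfolding C_def by (simp add: add_nonneg_pos)
      obtain c where c: "c \<in> A\<^sub>0" "norm (b - c) < e / C"
        using dense_approx[OF dense, of "e / C" b] e C by auto
      have "norm (\<alpha> s a * b - \<alpha> s a * c) \<le> e" for s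
      proof -
        have "norm (\<alpha> s a) \<le> C"
          using norm_star_automorphism_le[of "\<alpha> s" a] assms(3)
          unfolding C_def cstar_action_def by force
        then have "norm (\<alpha> s a) * norm (b - c) \<le> C * (e / C)"
          using c C by (intro mult_mono) auto
        then have "norm (\<alpha> s a * (b - c)) \<le> e"
          using norm_mult_ineq[of "\<alpha> s a" "b - c"] C by simp
        then show ?thesis by (simp add: right_diff_distrib)
      qed
      then show "\<exists>g. vanishes_at_infinity g \<and> (\<forall>s. norm (\<alpha> s a * b - g s) \<le> e)"
        using van[OF c(1)] by blast
    qed
  qed
next
  assume "\<exists>A\<^sub>0. closure A\<^sub>0 = UNIV \<and> action_invariant \<alpha> A\<^sub>0 \<and>
    (\<forall>a\<in>A\<^sub>0. \<forall>\<omega>. dual_element \<omega> \<longrightarrow> integrable \<mu> (\<lambda>s. \<omega> (\<alpha> s a)))"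
  then obtain A\<^sub>0 where dense: "closure A\<^sub>0 = UNIV"
    and int: "\<And>a \<omega>. a \<in> A\<^sub>0 \<Longrightarrow> dual_element \<omega> \<Longrightarrow> integrable \<mu> (\<lambda>s. \<omega> (\<alpha> s a))"
    by blast
  show "w_proper \<alpha>"
    unfolding w_proper_def C0_def
  proof (intro allI impI CollectI conjI)
    fix a and \<omega> :: "'a \<Rightarrow> complex" assume \<omega>: "dual_element \<omega>"
    then have lin: "bounded_linear \<omega>" unfolding dual_element_def by blast
    show "continuous_on UNIV (\<lambda>s. \<omega> (\<alpha> s a))"
      using assms(3) unfolding cstar_action_def
      by (intro bounded_linear.continuous_on[OF lin]) blast
    show "vanishes_at_infinity (\<lambda>s. \<omega> (\<alpha> s a))"
      by (rule bounded_linear_orbit_vanishes[OF assms lin dense])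
        (use int[OF _ \<omega>] in \<open>simp add: integrable_iff_bounded\<close>)
  qed
qed

end
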